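(* Let $\Gamma$ be a non-elementary Fuchsian subgroup of $\mathrm{PSL}_2(\mathbb{R})$ and let $h$ be a $\Gamma$-equivariant function. If $\Lambda(\Gamma)\cap \mathrm{Im}(h)$ is non-empty, then $h:\mathbb{H}\to\widehat{\mathbb{C}}$ is surjective, and for any $z\in\widehat{\mathbb{C}}$ the set $h^{-1}(\{z\})$ contains infinitely many non $\Gamma$-equivalent points.
   Context: $\mathbb{H}$ is the upper half-plane and $\widehat{\mathbb{C}}=\mathbb{C}\cup\{\infty\}$. $\mathrm{PSL}_2(\mathbb{R})=\mathrm{SL}_2(\mathbb{R})/\{\pm I\}$ acts on $\widehat{\mathbb{C}}$ by Möbius transformations, preserving $\mathbb{H}$ and $\mathbb{R}\cup\{\infty\}$. A Fuchsian group is a discrete subgroup of $\mathrm{PSL}_2(\mathbb{R})$. A subgroup is elementary if it has a finite orbit in $\mathbb{H}\cup\mathbb{R}\cup\{\infty\}$. The limit set $\Lambda(\Gamma)\subset\mathbb{R}\cup\{\infty\}$ of a Fuchsian group is the set of all limit points of orbits $\Gamma z$, $z\in\mathbb{H}$. A $\Gamma$-equivariant function is a meromorphic function $h$ on $\mathbb{H}$ (viewed as a map $\mathbb{H}\to\widehat{\mathbb{C}}$) such that $h(\gamma z)=\gamma(h(z))$ for all $\gamma\in\Gamma$, $z\in\mathbb{H}$. $\mathrm{Im}(h)=h(\mathbb{H})$. Points $z,w$ are $\Gamma$-equivalent if $w=\gamma z$ for some $\gamma\in\Gamma$. *)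

theory Defs
  imports "HOL-Complex_Analysis.Complex_Analysis" "HOL-Algebra.Coset"
begin

unbundle no Formal_Power_Series.fps_syntax

section \<open>The Riemann sphere\<close>

datatype riemann_sphere = Fin complex | Infty

text \<open>The topology is that of the one-point compactification of the complex plane.\<close>

instantiation riemann_sphere :: topological_space
begin

definition open_riemann_sphere :: "riemann_sphere set \<Rightarrow> bool" where
  "open_riemann_sphere U \<longleftrightarrow>
     open (Fin -` U) \<and> (Infty \<in> U \<longrightarrow> compact (- (Fin -` U)))"

instance
proof
  show "open (UNIV :: riemann_sphere set)"
    by (simp add: open_riemann_sphere_def)
next
  fix S T :: "riemann_sphere set"
  assume "open S" "open T"
  then show "open (S \<inter> T)"
    by (auto simp: open_riemann_sphere_def compact_Un)
next
  fix K :: "riemann_sphere set set"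
  assume K: "\<forall>S\<in>K. open S"
  have op: "open (Fin -` \<Union>K)"
    using K by (auto simp: open_riemann_sphere_def vimage_Union)
  moreover have "compact (- (Fin -` \<Union>K))" if "Infty \<in> \<Union>K"
  proof -
    from that obtain S where S: "S \<in> K" "Infty \<in> S" by blast
    then have "compact (- (Fin -` S))"
      using K by (auto simp: open_riemann_sphere_def)
    moreover have "closed (- (Fin -` \<Union>K))"
      using op by (simp add: closed_def)
    ultimately have "compact (- (Fin -` S) \<inter> - (Fin -` \<Union>K))"
      by (rule compact_Int_closed)
    moreover have "- (Fin -` S) \<inter> - (Fin -` \<Union>K) = - (Fin -` \<Union>K)"
      using S by blast
    ultimately show ?thesis by simp
  qed
  ultimately show "open (\<Union>K)"
    by (simp add: open_riemann_sphere_def)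
qed

end

definition upper_half_plane :: "complex set" where
  "upper_half_plane = {z. Im z > 0}"

definition extended_reals :: "riemann_sphere set" where
  "extended_reals = insert Infty (Fin ` {z. Im z = 0})"

text \<open>
  A complex function with a pole at a point takes a meaningless value there; this is the
  associated map to the Riemann sphere. It is meant for functions that are
  \<^const>\<open>nicely_meromorphic_on\<close> their domain, so that no other value is spurious.
\<close>

definition sphere_map :: "(complex \<Rightarrow> complex) \<Rightarrow> complex \<Rightarrow> riemann_sphere" where
  "sphere_map h z = (if is_pole h z then Infty else Fin (h z))"


section \<open>The topological group of real Moebius transformations\<close>

definition SL2R :: "(real^2^2) monoid" where
  "SL2R = \<lparr>carrier = {A. det A = 1}, monoid.mult = (**), one = mat 1\<rparr>"

definition PSL2R :: "(real^2^2) set monoid" where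
  "PSL2R = SL2R Mod {mat 1, - mat 1}"

text \<open>The quotient topology of the Euclidean subspace topology on the matrices.\<close>

definition PSL2R_topology :: "(real^2^2) set topology" where
  "PSL2R_topology = topology (\<lambda>U. U \<subseteq> carrier PSL2R \<and>
     openin (top_of_set (carrier SL2R))
       {A \<in> carrier SL2R. {mat 1, - mat 1} #>\<^bsub>SL2R\<^esub> A \<in> U})"

definition moebius :: "real^2^2 \<Rightarrow> riemann_sphere \<Rightarrow> riemann_sphere" where
  "moebius A x = (case x of
     Fin z \<Rightarrow>
       (if of_real (A$2$1) * z + of_real (A$2$2) = 0 then Infty
        else Fin ((of_real (A$1$1) * z + of_real (A$1$2)) /
                  (of_real (A$2$1) * z + of_real (A$2$2))))
   | Infty \<Rightarrow>
       (if A$2$1 = 0 then Infty else Fin (of_real (A$1$1 / A$2$1))))"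

text \<open>
  Elements of \<^const>\<open>PSL2R\<close> are cosets; all representatives act in the same way, see
  \<open>PSL2R_act_rcoset\<close> below.
\<close>

definition PSL2R_act :: "(real^2^2) set \<Rightarrow> riemann_sphere \<Rightarrow> riemann_sphere" where
  "PSL2R_act g x = the_elem ((\<lambda>A. moebius A x) ` g)"

definition orbit_of :: "(real^2^2) set set \<Rightarrow> riemann_sphere \<Rightarrow> riemann_sphere set" where
  "orbit_of \<Gamma> x = (\<lambda>g. PSL2R_act g x) ` \<Gamma>"


section \<open>Fuchsian groups and equivariant functions\<close>

definition Fuchsian :: "(real^2^2) set set \<Rightarrow> bool" where
  "Fuchsian \<Gamma> \<longleftrightarrow> subgroup \<Gamma> PSL2R \<and>
     subtopology PSL2R_topology \<Gamma> = discrete_topology \<Gamma>"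

definition elementary :: "(real^2^2) set set \<Rightarrow> bool" where
  "elementary \<Gamma> \<longleftrightarrow>
     (\<exists>x \<in> Fin ` upper_half_plane \<union> extended_reals. finite (orbit_of \<Gamma> x))"

definition limit_set :: "(real^2^2) set set \<Rightarrow> riemann_sphere set" where
  "limit_set \<Gamma> = {x. \<exists>z \<in> upper_half_plane. x islimpt orbit_of \<Gamma> (Fin z)}"

definition equivariant_function :: "(real^2^2) set set \<Rightarrow> (complex \<Rightarrow> complex) \<Rightarrow> bool" where
  "equivariant_function \<Gamma> h \<longleftrightarrow> h nicely_meromorphic_on upper_half_plane \<and>
     (\<forall>g\<in>\<Gamma>. \<forall>z\<in>upper_half_plane. \<forall>w\<in>upper_half_plane.
        Fin w = PSL2R_act g (Fin z) \<longrightarrow> sphere_map h w = PSL2R_act g (sphere_map h z))"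

definition equivalent_under :: "(real^2^2) set set \<Rightarrow> complex \<Rightarrow> complex \<Rightarrow> bool" where
  "equivalent_under \<Gamma> z w \<longleftrightarrow> (\<exists>g\<in>\<Gamma>. Fin w = PSL2R_act g (Fin z))"


section \<open>Well-definedness\<close>

lemma det_uminus_2: "det (- A :: real^2^2) = det A"
  by (simp add: det_2)

lemma minus_mat_mult [simp]: "(- mat 1) ** A = - (A :: real^2^2)"
  by (simp add: matrix_matrix_mult_def mat_def vec_eq_iff sum_2 forall_2)

lemma mult_minus_mat [simp]: "A ** (- mat 1) = - (A :: real^2^2)"
  by (simp add: matrix_matrix_mult_def mat_def vec_eq_iff sum_2 forall_2)

lemma group_SL2R: "group SL2R"
proof (rule groupI)
  fix A assume A: "A \<in> carrier SL2R"
  then have "invertible A"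
    by (simp add: SL2R_def invertible_det_nz)
  then obtain B where B: "B ** A = mat 1"
    by (auto simp: invertible_def)
  with A have "det B = 1"
    using det_mul[of B A] by (simp add: SL2R_def)
  with B show "\<exists>B\<in>carrier SL2R. B \<otimes>\<^bsub>SL2R\<^esub> A = \<one>\<^bsub>SL2R\<^esub>"
    by (auto simp: SL2R_def)
qed (auto simp: SL2R_def det_mul matrix_mul_assoc)

lemma normal_center_SL2R: "{mat 1, - mat 1} \<lhd> SL2R"
proof -
  interpret group SL2R by (rule group_SL2R)
  have one: "- mat 1 \<in> carrier SL2R"
    by (simp add: SL2R_def det_uminus_2)
  have "inv\<^bsub>SL2R\<^esub> (- mat 1) = - mat 1"
    using one by (intro inv_equality) (auto simp: SL2R_def)
  moreover have "inv\<^bsub>SL2R\<^esub> (mat 1) = mat 1"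
    by (intro inv_equality) (auto simp: SL2R_def)
  moreover have "{mat 1, - mat 1} \<subseteq> carrier SL2R"
    using one by (simp add: SL2R_def)
  ultimately have "subgroup {mat 1, - mat 1} SL2R"
    by (intro subgroupI) (auto simp: SL2R_def)
  then show ?thesis
    by (rule normalI) (simp add: r_coset_def l_coset_def SL2R_def)
qed

lemma group_PSL2R: "group PSL2R"
  unfolding PSL2R_def by (rule normal.factorgroup_is_group[OF normal_center_SL2R])

lemma rcoset_center_SL2R: "{mat 1, - mat 1} #>\<^bsub>SL2R\<^esub> A = {A, - A}"
  by (auto simp: r_coset_def SL2R_def)

lemma carrier_PSL2R: "carrier PSL2R = (\<lambda>A. {A, - A}) ` {A. det A = 1}"
  unfolding PSL2R_def FactGroup_def RCOSETS_def rcoset_center_SL2R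
  by (auto simp: SL2R_def)

lemma openin_PSL2R_topology:
  "openin PSL2R_topology U \<longleftrightarrow> U \<subseteq> carrier PSL2R \<and>
     openin (top_of_set (carrier SL2R))
       {A \<in> carrier SL2R. {mat 1, - mat 1} #>\<^bsub>SL2R\<^esub> A \<in> U}"
proof -
  let ?p = "\<lambda>A. {mat 1, - mat 1} #>\<^bsub>SL2R\<^esub> A"
  let ?Q = "\<lambda>U. {A \<in> carrier SL2R. ?p A \<in> U}"
  have Int: "?Q (S \<inter> T) = ?Q S \<inter> ?Q T" for S T by blast
  have Un: "?Q (\<Union>K) = \<Union> (?Q ` K)" for K by blast
  have "istopology (\<lambda>U. U \<subseteq> carrier PSL2R \<and> openin (top_of_set (carrier SL2R)) (?Q U))"
    unfolding istopology_def Int Un by (blast intro: openin_Int openin_Union)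
  then show ?thesis
    unfolding PSL2R_topology_def by (simp add: topology_inverse')
qed

lemma quotient_map_PSL2R:
  "quotient_map (top_of_set (carrier SL2R)) PSL2R_topology
     (\<lambda>A. {mat 1, - mat 1} #>\<^bsub>SL2R\<^esub> A)"
proof -
  have img: "(\<lambda>A. {mat 1, - mat 1} #>\<^bsub>SL2R\<^esub> A) ` carrier SL2R = carrier PSL2R"
    unfolding PSL2R_def FactGroup_def RCOSETS_def by auto
  have "{A \<in> carrier SL2R. {mat 1, - mat 1} #>\<^bsub>SL2R\<^esub> A \<in> carrier PSL2R} = carrier SL2R"
    using img by blast
  then have "openin PSL2R_topology (carrier PSL2R)"
    unfolding openin_PSL2R_topology by (metis openin_subtopology_self subset_refl)
  then have "topspace PSL2R_topology = carrier PSL2R"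
    by (meson openin_PSL2R_topology openin_subset openin_topspace subset_antisym)
  with img show ?thesis
    by (auto simp: quotient_map_def openin_PSL2R_topology)
qed

lemma moebius_uminus: "moebius (- A) x = moebius A x"
proof (cases x)
  case (Fin z)
  have eq: "- (of_real (A$2$1) * z) - of_real (A$2$2) = - (of_real (A$2$1) * z + of_real (A$2$2))"
    "- (of_real (A$1$1) * z) - of_real (A$1$2) = - (of_real (A$1$1) * z + of_real (A$1$2))"
    by simp_all
  show ?thesis
    unfolding moebius_def Fin by (simp add: eq del: minus_add_distrib)
qed (simp add: moebius_def)

lemma PSL2R_act_rcoset: "PSL2R_act ({mat 1, - mat 1} #>\<^bsub>SL2R\<^esub> A) x = moebius A x"
  by (simp add: PSL2R_act_def rcoset_center_SL2R moebius_uminus)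

lemma PSL2R_act_upper_half_plane:
  assumes "g \<in> carrier PSL2R" "z \<in> upper_half_plane"
  shows "PSL2R_act g (Fin z) \<in> Fin ` upper_half_plane"
proof -
  from assms(1) obtain A where A: "det A = 1" "g = {A, - A}"
    by (auto simp: carrier_PSL2R)
  define a b c d where "a = A$1$1" "b = A$1$2" "c = A$2$1" "d = A$2$2"
  have det: "a * d - b * c = 1"
    using A(1) by (simp add: det_2 a_b_c_d_def)
  have z: "Im z > 0"
    using assms(2) by (simp add: upper_half_plane_def)
  have nz: "of_real c * z + of_real d \<noteq> 0"
  proof
    assume *: "of_real c * z + of_real d = 0"
    then have "Im (of_real c * z + of_real d) = 0" by simp
    then have "c * Im z = 0" by simp
    with z have "c = 0" by simp
    with * det show False by simp
  qed
  have "Im ((of_real a * z + of_real b) / (of_real c * z + of_real d)) =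
        (a * d - b * c) * Im z / (cmod (of_real c * z + of_real d))\<^sup>2"
    by (simp add: Im_divide cmod_power2 algebra_simps)
  also have "\<dots> > 0"
    using det z nz by simp
  finally have "Fin ((of_real a * z + of_real b) / (of_real c * z + of_real d))
      \<in> Fin ` upper_half_plane"
    by (simp add: upper_half_plane_def)
  moreover have "PSL2R_act g (Fin z) = moebius A (Fin z)"
    by (simp add: A(2) PSL2R_act_def moebius_uminus)
  ultimately show ?thesis
    using nz by (simp add: moebius_def a_b_c_d_def)
qed

end

theory Submission
  imports Defs
begin

text \<open>
  Let \<open>h z0 = x0\<close> be a limit point. Limit points are accumulation points of the orbit of
  every point \<open>x\<close> of the sphere: there are \<open>\<gamma>\<^sub>n\<close> in the group that converge to the constant \<open>x0\<close>
  away from a single point, and the orbit of \<open>x\<close> is infinite because the group is not elementary.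
  As \<open>h\<close> is an open map, \<open>z0\<close> is then an accumulation point of the points \<open>v\<close> for which
  \<open>h v\<close> is in the orbit of \<open>x\<close>. By equivariance these \<open>v\<close> form the union of the orbits of the
  preimages of \<open>x\<close>, and by discreteness no finite union of orbits accumulates inside the half-plane.
\<close>

section \<open>The Riemann sphere and homogeneous coordinates\<close>

lemma open_Fin_image: "open (Fin ` S) \<longleftrightarrow> open S"
proof -
  have "Fin -` Fin ` S = S" by auto
  then show ?thesis by (auto simp: open_riemann_sphere_def)
qed

lemma open_Compl_Fin_image:
  assumes "compact K"
  shows "open (- Fin ` K)"
proof -
  have "Fin -` (- Fin ` K) = - K" by auto
  with assms show ?thesis
    by (simp add: open_riemann_sphere_def compact_imp_closed open_Compl)
qed

lemma open_at_Infty: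
  assumes "open V" "Infty \<in> V"
  obtains R where "R > 0" "- Fin ` cball 0 R \<subseteq> V"
proof -
  have "bounded (- (Fin -` V))"
    using assms by (auto simp: open_riemann_sphere_def compact_imp_bounded)
  then obtain R where R: "R > 0" "\<forall>x\<in>- (Fin -` V). norm x \<le> R"
    by (auto simp: bounded_pos)
  have "- Fin ` cball 0 R \<subseteq> V"
  proof
    fix x assume x: "x \<in> - Fin ` cball 0 R"
    show "x \<in> V"
    proof (cases x)
      case (Fin z)
      with x have "norm z > R" by force
      with R(2) have "z \<in> Fin -` V" by force
      then show ?thesis by (simp add: Fin)
    qed (use assms in simp)
  qed
  with R(1) that show ?thesis by blast
qed

text \<open>Separation makes limits in the sphere unique and finite sets closed; the study of limit
  points rests on both. Around a finite point and \<open>Infty\<close>, a disc and the complement of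
  its closure do the separating.\<close>

instance riemann_sphere :: t2_space
proof
  fix x y :: riemann_sphere
  assume ne: "x \<noteq> y"
  have sep: "open (Fin ` ball w 1)" "open (- Fin ` cball w 1)"
    "Fin w \<in> Fin ` ball w 1" "Infty \<in> - Fin ` cball w 1"
    "Fin ` ball w 1 \<inter> - Fin ` cball w 1 = {}" for w
    using ball_subset_cball[of w 1]
    by (blast | simp add: open_Fin_image open_Compl_Fin_image)+
  show "\<exists>U V. open U \<and> open V \<and> x \<in> U \<and> y \<in> V \<and> U \<inter> V = {}"
  proof (cases x)
    case x: (Fin z)
    show ?thesis
    proof (cases y)
      case y: (Fin w)
      have "z \<noteq> w" using ne by (simp add: x y)
      then obtain U V where UV: "open U" "open V" "z \<in> U" "w \<in> V" "U \<inter> V = {}"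
        using hausdorff[OF \<open>z \<noteq> w\<close>] by metis
      then have "Fin ` U \<inter> Fin ` V = {}" by auto
      with UV show ?thesis
        unfolding x y by (intro exI[of _ "Fin ` U"] exI[of _ "Fin ` V"]) (simp add: open_Fin_image)
    next
      case y: Infty
      show ?thesis
        unfolding x y by (intro exI[of _ "Fin ` ball z 1"] exI[of _ "- Fin ` cball z 1"] conjI sep)
    qed
  next
    case x: Infty
    with ne obtain w where y: "y = Fin w" by (cases y) auto
    show ?thesis
      unfolding x y using sep(5)[of w]
      by (intro exI[of _ "- Fin ` cball w 1"] exI[of _ "Fin ` ball w 1"] conjI sep)
        (simp add: Int_commute)
  qed
qed

text \<open>Needed to reach limit points by sequences. At \<open>Infty\<close> the complements of
  the closed discs of integral radius form a countable base.\<close>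

instance riemann_sphere :: first_countable_topology
proof
  fix x :: riemann_sphere
  show "\<exists>A::nat \<Rightarrow> riemann_sphere set. (\<forall>i. x \<in> A i \<and> open (A i)) \<and>
          (\<forall>S. open S \<and> x \<in> S \<longrightarrow> (\<exists>i. A i \<subseteq> S))"
  proof (cases x)
    case (Fin z)
    obtain B :: "nat \<Rightarrow> complex set" where B: "\<forall>i. z \<in> B i \<and> open (B i)"
      "\<forall>S. open S \<and> z \<in> S \<longrightarrow> (\<exists>i. B i \<subseteq> S)"
      using first_countable_basis[of z] by blast
    have "\<exists>i. Fin ` B i \<subseteq> S" if "open S" "x \<in> S" for S
    proof -
      have "open (Fin -` S)" "z \<in> Fin -` S"
        using that Fin by (auto simp: open_riemann_sphere_def)
      with B(2) obtain i where "B i \<subseteq> Fin -` S" by blast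
      then show ?thesis by blast
    qed
    with B(1) Fin show ?thesis
      by (intro exI[of _ "\<lambda>i. Fin ` B i"]) (auto simp: open_Fin_image)
  next
    case Infty
    have "\<exists>i::nat. - Fin ` cball 0 (real i) \<subseteq> S" if S: "open S" "x \<in> S" for S
    proof -
      from S Infty obtain R where R: "- Fin ` cball 0 R \<subseteq> S"
        using open_at_Infty by blast
      obtain i :: nat where "R \<le> real i"
        using real_arch_simple by blast
      then have "cball (0::complex) R \<subseteq> cball 0 (real i)" by auto
      with R show ?thesis by blast
    qed
    with Infty show ?thesis
      by (intro exI[of _ "\<lambda>i. - Fin ` cball 0 (real i)"]) (auto simp: open_Compl_Fin_image)
  qed
qed

lemma tendsto_Fin [tendsto_intros]:
  assumes "(f \<longlongrightarrow> l) F"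
  shows "((\<lambda>x. Fin (f x)) \<longlongrightarrow> Fin l) F"
proof (rule topological_tendstoI)
  fix S assume "open S" "Fin l \<in> S"
  then have "open (Fin -` S)" "l \<in> Fin -` S"
    by (auto simp: open_riemann_sphere_def)
  with assms have "\<forall>\<^sub>F x in F. f x \<in> Fin -` S"
    by (rule topological_tendstoD)
  then show "\<forall>\<^sub>F x in F. Fin (f x) \<in> S" by simp
qed

section \<open>Homogeneous coordinates and the linear action behind \<open>moebius\<close>\<close>

definition sphere_point :: "complex \<times> complex \<Rightarrow> riemann_sphere" where
  "sphere_point v = (if snd v = 0 then Infty else Fin (fst v / snd v))"

fun homog :: "riemann_sphere \<Rightarrow> complex \<times> complex" where
  "homog (Fin z) = (z, 1)"
| "homog Infty = (1, 0)"

text \<open>Being linear in the matrix, this also makes sense for singular matrices, which arise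
  below as limits of rescaled group elements.\<close>

definition mat_act :: "real^2^2 \<Rightarrow> complex \<times> complex \<Rightarrow> complex \<times> complex" where
  "mat_act A v = (of_real (A$1$1) * fst v + of_real (A$1$2) * snd v,
                  of_real (A$2$1) * fst v + of_real (A$2$2) * snd v)"

lemma moebius_eq_sphere_point: "moebius A x = sphere_point (mat_act A (homog x))"
  by (cases x) (auto simp: moebius_def sphere_point_def mat_act_def)

lemma homog_nonzero: "homog x \<noteq> 0"
  by (cases x) (auto simp: zero_prod_def)

lemma sphere_point_homog [simp]: "sphere_point (homog x) = x"
  by (cases x) (auto simp: sphere_point_def)

text \<open>Two nonzero vectors give the same point iff they are proportional. The zero vector
  represents no point; \<open>sphere_point\<close> gives it the default value \<open>Infty\<close>,
  whence the hypotheses.\<close>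

lemma sphere_point_eq_iff:
  assumes "v \<noteq> 0" "w \<noteq> 0"
  shows "sphere_point v = sphere_point w \<longleftrightarrow> fst v * snd w = fst w * snd v"
  using assms by (cases v; cases w) (auto simp: sphere_point_def zero_prod_def field_simps)

lemma mat_act_mult: "mat_act (A ** B) v = mat_act A (mat_act B v)"
  by (simp add: mat_act_def matrix_matrix_mult_def sum_2 algebra_simps)

lemma mat_act_mat_1 [simp]: "mat_act (mat 1) v = v"
  by (simp add: mat_act_def mat_def)

lemma mat_act_zero [simp]: "mat_act A 0 = 0"
  by (simp add: mat_act_def zero_prod_def)

lemma mat_act_scaleR: "mat_act (r *\<^sub>R A) v = r *\<^sub>R mat_act A v"
  by (simp add: mat_act_def scaleR_prod_def scaleR_conv_of_real[where 'a = complex] algebra_simps)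

lemma sphere_point_scaleR: "r \<noteq> 0 \<Longrightarrow> sphere_point (r *\<^sub>R v) = sphere_point v"
  by (simp add: sphere_point_def scaleR_conv_of_real)

text \<open>Multiplicativity of the determinant, applied to the matrix with columns \<open>v\<close>
  and \<open>w\<close>. It shows that invertible matrices keep points apart and singular ones merge
  them.\<close>

lemma mat_act_cross:
  "fst (mat_act A v) * snd (mat_act A w) - fst (mat_act A w) * snd (mat_act A v)
     = of_real (det A) * (fst v * snd w - fst w * snd v)"
  by (simp add: mat_act_def det_2 algebra_simps)

text \<open>The adjugate: the inverse when the determinant is 1, with entries that depend
  continuously on those of \<open>A\<close>.\<close>

definition adj2 :: "real^2^2 \<Rightarrow> real^2^2" where
  "adj2 A = vector [vector [A$2$2, - A$1$2], vector [- A$2$1, A$1$1]]"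

lemma adj2_mult: "adj2 A ** A = det A *\<^sub>R mat 1" "A ** adj2 A = det A *\<^sub>R mat 1"
  by (simp_all add: adj2_def matrix_matrix_mult_def mat_def vec_eq_iff sum_2 forall_2 det_2 algebra_simps)

lemma det_adj2: "det (adj2 A) = det A"
  by (simp add: adj2_def det_2)

lemma mat_act_nonzero:
  assumes "det A \<noteq> 0" "v \<noteq> 0"
  shows "mat_act A v \<noteq> 0"
proof
  assume "mat_act A v = 0"
  then have "mat_act (adj2 A ** A) v = 0"
    by (simp add: mat_act_mult)
  with assms show False
    by (simp add: adj2_mult mat_act_scaleR)
qed

text \<open>Composition is clear for linear maps. What remains is that the image point depends only
  on the point \<open>sphere_point v\<close>, not on its representative \<open>v\<close>, and
  \<open>mat_act_cross\<close> gives this.\<close>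

lemma moebius_mult:
  assumes "det A \<noteq> 0" "det B \<noteq> 0"
  shows "moebius (A ** B) x = moebius A (moebius B x)"
proof -
  define v where "v = mat_act B (homog x)"
  have v: "v \<noteq> 0" using assms homog_nonzero by (simp add: v_def mat_act_nonzero)
  have "fst v * snd (homog (sphere_point v)) = fst (homog (sphere_point v)) * snd v"
    using v homog_nonzero by (subst sphere_point_eq_iff [symmetric]) simp_all
  moreover have "mat_act A w \<noteq> 0" if "w \<noteq> 0" for w
    using assms that by (simp add: mat_act_nonzero)
  ultimately have "sphere_point (mat_act A v) = sphere_point (mat_act A (homog (sphere_point v)))"
    using mat_act_cross[of A v "homog (sphere_point v)"] v homog_nonzero
    by (subst sphere_point_eq_iff) auto
  then show ?thesis
    by (simp add: moebius_eq_sphere_point mat_act_mult v_def)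
qed

lemma moebius_mat_1 [simp]: "moebius (mat 1) x = x"
  by (simp add: moebius_eq_sphere_point)

lemma moebius_adj2:
  assumes "det A = 1"
  shows "moebius (adj2 A) (moebius A x) = x" "moebius A (moebius (adj2 A) x) = x"
  using moebius_mult[of "adj2 A" A x] moebius_mult[of A "adj2 A" x] assms
  by (simp_all add: adj2_mult det_adj2)

lemma inj_moebius: "det A = 1 \<Longrightarrow> inj (moebius A)"
  by (metis injI moebius_adj2(1))

lemma moebius_upper_half_plane:
  assumes "det A = 1" "z \<in> upper_half_plane"
  shows "moebius A (Fin z) \<in> Fin ` upper_half_plane"
proof -
  have "{A, - A} \<in> carrier PSL2R" using assms(1) by (auto simp: carrier_PSL2R)
  from PSL2R_act_upper_half_plane[OF this assms(2)] show ?thesis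
    by (simp add: PSL2R_act_def moebius_uminus)
qed

lemma tendsto_sphere_point [tendsto_intros]:
  assumes f: "(f \<longlongrightarrow> v) F" and v: "v \<noteq> 0"
  shows "((\<lambda>x. sphere_point (f x)) \<longlongrightarrow> sphere_point v) F"
proof (cases "snd v = 0")
  case False
  have s: "((\<lambda>x. snd (f x)) \<longlongrightarrow> snd v) F"
    using f by (rule tendsto_snd)
  have "((\<lambda>x. Fin (fst (f x) / snd (f x))) \<longlongrightarrow> Fin (fst v / snd v)) F"
    using f False by (intro tendsto_intros)
  moreover have "\<forall>\<^sub>F x in F. Fin (fst (f x) / snd (f x)) = sphere_point (f x)"
    using tendsto_imp_eventually_ne[OF s False] by eventually_elim (simp add: sphere_point_def)
  ultimately show ?thesis
    using False by (simp add: sphere_point_def[of v] tendsto_cong)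
next
  case True
  show ?thesis
  proof (rule topological_tendstoI)
    fix S assume "open S" "sphere_point v \<in> S"
    with True obtain R where R: "R > 0" "- Fin ` cball 0 R \<subseteq> S"
      using open_at_Infty[of S] by (auto simp: sphere_point_def)
    \<comment> \<open>Comparing \<open>norm (fst v)\<close> with \<open>R * norm (snd v)\<close>
      expresses closeness to \<open>Infty\<close> without a division, so vectors with second
      coordinate 0 need no separate treatment.\<close>
    have "((\<lambda>x. norm (fst (f x)) - R * norm (snd (f x))) \<longlongrightarrow> norm (fst v) - R * norm (snd v)) F"
      by (intro tendsto_intros f)
    moreover have "norm (fst v) - R * norm (snd v) > 0"
      using True v by (cases v) (auto simp: zero_prod_def)
    ultimately have "\<forall>\<^sub>F x in F. norm (fst (f x)) - R * norm (snd (f x)) > 0"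
      by (rule order_tendstoD)
    then show "\<forall>\<^sub>F x in F. sphere_point (f x) \<in> S"
    proof eventually_elim
      case (elim x)
      have "sphere_point (f x) \<notin> Fin ` cball 0 R"
        using elim by (auto simp: sphere_point_def norm_divide field_simps split: if_splits)
      with R(2) show ?case by blast
    qed
  qed
qed

lemma tendsto_mat_act [tendsto_intros]:
  assumes "(f \<longlongrightarrow> A) F"
  shows "((\<lambda>x. mat_act (f x) v) \<longlongrightarrow> mat_act A v) F"
  unfolding mat_act_def by (intro tendsto_intros assms)

text \<open>By \<open>mat_act_cross\<close> any two images under a singular matrix are
  proportional.\<close>

lemma rank_one_common_value:
  assumes "det B = 0" "mat_act B v \<noteq> 0" "mat_act B w \<noteq> 0"
  shows "sphere_point (mat_act B v) = sphere_point (mat_act B w)"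
  using assms mat_act_cross[of B v w] by (simp add: sphere_point_eq_iff)

text \<open>Different points have linearly independent homogeneous coordinates, and a row of
  \<open>B\<close> that vanishes on two such vectors is zero.\<close>

lemma mat_act_homog_kernel_unique:
  assumes "B \<noteq> 0" "mat_act B (homog x) = 0" "mat_act B (homog y) = 0"
  shows "x = y"
proof (rule ccontr)
  assume "x \<noteq> y"
  define v w D where "v = homog x" and "w = homog y" and "D = fst v * snd w - fst w * snd v"
  have D: "D \<noteq> 0"
    using \<open>x \<noteq> y\<close> sphere_point_eq_iff[OF homog_nonzero homog_nonzero, of x y]
    by (simp add: v_def w_def D_def)
  have row: "a = 0 \<and> b = 0"
    if "of_real a * fst v + of_real b * snd v = 0" "of_real a * fst w + of_real b * snd w = 0"
    for a b :: real
  proof -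
    \<comment> \<open>Cramer's rule for the two equations in \<open>a\<close> and
      \<open>b\<close>.\<close>
    have "of_real a * D = snd w * (of_real a * fst v + of_real b * snd v)
                        - snd v * (of_real a * fst w + of_real b * snd w)"
      "of_real b * D = fst v * (of_real a * fst w + of_real b * snd w)
                     - fst w * (of_real a * fst v + of_real b * snd v)"
      by (simp_all add: D_def algebra_simps)
    then have "of_real a * D = 0" "of_real b * D = 0"
      unfolding that by simp_all
    with D show ?thesis by simp
  qed
  have "B$1$1 = 0 \<and> B$1$2 = 0" "B$2$1 = 0 \<and> B$2$2 = 0"
    using assms(2,3) by (auto intro!: row simp: mat_act_def zero_prod_def v_def w_def)
  then have "B = 0" by (simp add: vec_eq_iff forall_2)
  with assms(1) show False by simp
qed

text \<open>The rows of \<open>B\<close> are real: taking imaginary parts in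
  \<open>a z + b = 0\<close> forces \<open>a = 0\<close>, and then \<open>b = 0\<close>.\<close>

lemma mat_act_kernel_upper_half_plane:
  assumes "z \<in> upper_half_plane" "mat_act B (homog (Fin z)) = 0"
  shows "B = 0"
proof -
  have row: "a = 0 \<and> b = 0" if "of_real a * z + of_real b = 0" for a b :: real
  proof -
    have "a * Im z = 0" using arg_cong[OF that, of Im] by simp
    then have "a = 0" using assms(1) by (simp add: upper_half_plane_def)
    with that show ?thesis by simp
  qed
  have "B$1$1 = 0 \<and> B$1$2 = 0" "B$2$1 = 0 \<and> B$2$2 = 0"
    using assms(2) by (intro row, simp add: mat_act_def zero_prod_def)+
  then show ?thesis by (simp add: vec_eq_iff forall_2)
qed

section \<open>Discreteness\<close>

lemma tendsto_matrix2:
  assumes "\<And>i j. ((\<lambda>x. f x $ i $ j) \<longlongrightarrow> A $ i $ j) F"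
  shows "(f \<longlongrightarrow> (A :: real^2^2)) F"
  by (intro vec_tendstoI assms)

lemma tendsto_matrix_mult2:
  fixes f g :: "'b \<Rightarrow> real^2^2"
  assumes "(f \<longlongrightarrow> A) F" "(g \<longlongrightarrow> B) F"
  shows "((\<lambda>x. f x ** g x) \<longlongrightarrow> A ** B) F"
  unfolding matrix_matrix_mult_def
  by (intro tendsto_vec_lambda tendsto_sum tendsto_mult tendsto_vec_nth assms)

lemma tendsto_adj2:
  assumes "(f \<longlongrightarrow> A) F"
  shows "((\<lambda>x. adj2 (f x)) \<longlongrightarrow> adj2 A) F"
proof (rule tendsto_matrix2)
  fix i j :: 2
  show "((\<lambda>x. adj2 (f x) $ i $ j) \<longlongrightarrow> adj2 A $ i $ j) F"
    using exhaust_2[of i] exhaust_2[of j]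
    by (elim disjE) (auto simp: adj2_def intro!: tendsto_intros assms)
qed

lemma tendsto_det2:
  fixes f :: "'b \<Rightarrow> real^2^2"
  assumes "(f \<longlongrightarrow> A) F"
  shows "((\<lambda>x. det (f x)) \<longlongrightarrow> det A) F"
  unfolding det_2 by (intro tendsto_intros assms)

section \<open>Passing from cosets to the preimage of the group in \<open>SL2R\<close>\<close>

definition lifts :: "(real^2^2) set set \<Rightarrow> (real^2^2) set" where
  "lifts \<Gamma> = {A. det A = 1 \<and> {A, - A} \<in> \<Gamma>}"

lemma lifts_det: "A \<in> lifts \<Gamma> \<Longrightarrow> det A = 1"
  by (simp add: lifts_def)

lemma PSL2R_act_pair: "PSL2R_act {A, - A} x = moebius A x"
  by (simp add: PSL2R_act_def moebius_uminus)

context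
  fixes \<Gamma> :: "(real^2^2) set set"
  assumes subgroup: "subgroup \<Gamma> PSL2R"
begin

lemma subgroup_eq_lifts: "\<Gamma> = (\<lambda>A. {A, - A}) ` lifts \<Gamma>"
  using subgroup.subset[OF subgroup] unfolding carrier_PSL2R lifts_def by auto

lemma orbit_of_lifts: "orbit_of \<Gamma> x = (\<lambda>A. moebius A x) ` lifts \<Gamma>"
  unfolding orbit_of_def by (subst subgroup_eq_lifts) (simp add: image_image PSL2R_act_pair)

lemma equivalent_under_lifts:
  "equivalent_under \<Gamma> z w \<longleftrightarrow> (\<exists>A\<in>lifts \<Gamma>. Fin w = moebius A (Fin z))"
  unfolding equivalent_under_def by (subst subgroup_eq_lifts) (simp add: PSL2R_act_pair)

lemma one_PSL2R: "\<one>\<^bsub>PSL2R\<^esub> = {mat 1, - mat 1}"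
  by (simp add: PSL2R_def)

lemma mult_PSL2R: "{A, - A} \<otimes>\<^bsub>PSL2R\<^esub> {B, - B} = {A ** B, - (A ** B)}"
proof -
  have "(- A) ** B = - (A ** B)" "A ** (- B) = - (A ** B)" "(- A) ** (- B) = A ** B"
    by (simp_all add: matrix_matrix_mult_def vec_eq_iff sum_negf)
  then show ?thesis
    by (auto simp: PSL2R_def set_mult_def SL2R_def)
qed

lemma lifts_one: "mat 1 \<in> lifts \<Gamma>"
  using subgroup.one_closed[OF subgroup] by (simp add: lifts_def one_PSL2R)

lemma lifts_mult: "A \<in> lifts \<Gamma> \<Longrightarrow> B \<in> lifts \<Gamma> \<Longrightarrow> A ** B \<in> lifts \<Gamma>"
  using subgroup.m_closed[OF subgroup, of "{A, - A}" "{B, - B}"]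
  by (simp add: lifts_def det_mul mult_PSL2R)

lemma lifts_adj2:
  assumes "A \<in> lifts \<Gamma>"
  shows "adj2 A \<in> lifts \<Gamma>"
proof -
  have A: "det A = 1" "{A, - A} \<in> \<Gamma>" using assms by (auto simp: lifts_def)
  have carr: "{B, - B} \<in> carrier PSL2R" if "det B = 1" for B
    using that by (auto simp: carrier_PSL2R)
  have "inv\<^bsub>PSL2R\<^esub> {A, - A} = {adj2 A, - adj2 A}"
    by (rule group.inv_equality[OF group_PSL2R])
      (simp_all add: mult_PSL2R one_PSL2R adj2_mult A carr det_adj2)
  with subgroup.m_inv_closed[OF subgroup A(2)] A(1) show ?thesis
    by (simp add: lifts_def det_adj2)
qed

lemma equivalent_under_sym: "equivalent_under \<Gamma> z w \<Longrightarrow> equivalent_under \<Gamma> w z"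
  unfolding equivalent_under_lifts by (metis lifts_adj2 lifts_det moebius_adj2(1))

lemma equivalent_under_trans:
  assumes "equivalent_under \<Gamma> z w" "equivalent_under \<Gamma> w u"
  shows "equivalent_under \<Gamma> z u"
proof -
  from assms obtain A B where "A \<in> lifts \<Gamma>" "Fin w = moebius A (Fin z)"
    "B \<in> lifts \<Gamma>" "Fin u = moebius B (Fin w)"
    unfolding equivalent_under_lifts by blast
  then show ?thesis
    unfolding equivalent_under_lifts
    by (intro bexI[of _ "B ** A"]) (simp_all add: moebius_mult lifts_det lifts_mult)
qed

lemma equivalent_under_refl: "equivalent_under \<Gamma> z z"
  unfolding equivalent_under_lifts using lifts_one by force

end

section \<open>Discreteness in terms of matrices\<close>

lemma Fuchsian_subgroup: "Fuchsian \<Gamma> \<Longrightarrow> subgroup \<Gamma> PSL2R"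
  by (simp add: Fuchsian_def)

text \<open>An open set of cosets that isolates the identity pulls back to an open set of matrices
  whose only lifts are \<open>mat 1\<close> and \<open>- mat 1\<close>.\<close>

lemma Fuchsian_isolated_one:
  assumes "Fuchsian \<Gamma>"
  obtains U where "open U" "mat 1 \<in> U" "lifts \<Gamma> \<inter> U \<subseteq> {mat 1}"
proof -
  let ?one = "{mat 1, - mat 1} :: (real^2^2) set"
  have one: "?one \<in> \<Gamma>"
    using lifts_one[OF Fuchsian_subgroup[OF assms]] by (simp add: lifts_def)
  then have "openin (subtopology PSL2R_topology \<Gamma>) {?one}"
    using assms by (simp add: Fuchsian_def)
  then obtain T where T: "openin PSL2R_topology T" "{?one} = T \<inter> \<Gamma>"
    unfolding openin_subtopology by (elim exE conjE) (rule that)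
  have oneT: "?one \<in> T" using T(2) by blast
  from T(1) have "openin (top_of_set (carrier SL2R)) {A \<in> carrier SL2R. {A, - A} \<in> T}"
    by (simp add: openin_PSL2R_topology rcoset_center_SL2R)
  then obtain V where V: "open V" "{A \<in> carrier SL2R. {A, - A} \<in> T} = carrier SL2R \<inter> V"
    unfolding openin_open by (elim exE conjE) (rule that)
  \<comment> \<open>The condition on the upper left entry discards \<open>- mat 1\<close>.\<close>
  define U where "U = V \<inter> {A. A$1$1 > 0}"
  have "open {A :: real^2^2. A$1$1 > 0}"
    by (intro open_Collect_less continuous_intros)
  then have "open U" using V(1) by (simp add: U_def open_Int)
  moreover have "mat 1 \<in> {A \<in> carrier SL2R. {A, - A} \<in> T}"
    using oneT by (simp add: SL2R_def)
  then have "mat 1 \<in> U"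
    unfolding V(2) by (simp add: U_def mat_def)
  moreover have "lifts \<Gamma> \<inter> U \<subseteq> {mat 1}"
  proof
    fix A assume A: "A \<in> lifts \<Gamma> \<inter> U"
    then have "A \<in> carrier SL2R \<inter> V" by (simp add: U_def SL2R_def lifts_def)
    then have "{A, - A} \<in> T" unfolding V(2) [symmetric] by simp
    moreover have "{A, - A} \<in> \<Gamma>" using A by (simp add: lifts_def)
    ultimately have "{A, - A} \<in> {?one}" unfolding T(2) by (rule IntI)
    then have "A = mat 1 \<or> A = - mat 1" by (auto simp only: singleton_iff doubleton_eq_iff)
    moreover have "A \<noteq> - mat 1"
    proof
      assume "A = - mat 1"
      then have "A$1$1 = -1" by (simp add: mat_def)
      then show False using A by (simp add: U_def)
    qed
    ultimately show "A \<in> {mat 1}" by simp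
  qed
  ultimately show ?thesis by (rule that)
qed

text \<open>Otherwise compactness yields a convergent sequence of distinct lifts. Its limit still
  has determinant 1, so the quotients of consecutive terms tend to \<open>mat 1\<close>; as that is
  isolated, some quotient equals it, and two terms coincide.\<close>

lemma finite_bounded_lifts:
  assumes "Fuchsian \<Gamma>"
  shows "finite {A \<in> lifts \<Gamma>. norm A \<le> R}"
proof (rule ccontr)
  note sub = Fuchsian_subgroup[OF assms]
  assume "infinite {A \<in> lifts \<Gamma>. norm A \<le> R}"
  then obtain f :: "nat \<Rightarrow> real^2^2" where f: "inj f" "range f \<subseteq> {A \<in> lifts \<Gamma>. norm A \<le> R}"
    using infinite_countable_subset by blast
  have "\<forall>n. f n \<in> cball 0 R" using f(2) by auto
  then obtain A r where r: "strict_mono (r :: nat \<Rightarrow> nat)" and lim: "(f \<circ> r) \<longlonglongrightarrow> A"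
    using compact_cball[of "0 :: real^2^2" R] unfolding compact_def by blast
  define g where "g = f \<circ> r"
  have g: "g n \<in> lifts \<Gamma>" for n using f(2) by (auto simp: g_def)
  have lim: "g \<longlonglongrightarrow> A" using lim by (simp add: g_def)
  have "(\<lambda>n. det (g n)) \<longlonglongrightarrow> det A" by (rule tendsto_det2[OF lim])
  then have "det A = 1"
    using lifts_det[OF g] by (simp add: LIMSEQ_const_iff)
  have "(\<lambda>n. adj2 (g n) ** g (Suc n)) \<longlonglongrightarrow> adj2 A ** A"
    by (intro tendsto_matrix_mult2 tendsto_adj2 lim LIMSEQ_Suc)
  then have lim1: "(\<lambda>n. adj2 (g n) ** g (Suc n)) \<longlonglongrightarrow> mat 1"
    using \<open>det A = 1\<close> by (simp add: adj2_mult)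
  obtain U where U: "open U" "mat 1 \<in> U" "lifts \<Gamma> \<inter> U \<subseteq> {mat 1}"
    using Fuchsian_isolated_one[OF assms] by blast
  from topological_tendstoD[OF lim1 U(1,2)] obtain n where "adj2 (g n) ** g (Suc n) \<in> U"
    by (auto simp: eventually_sequentially)
  moreover have "adj2 (g n) ** g (Suc n) \<in> lifts \<Gamma>"
    by (intro lifts_mult lifts_adj2 sub g)
  ultimately have "adj2 (g n) ** g (Suc n) = mat 1" using U(3) by blast
  then have "g n ** (adj2 (g n) ** g (Suc n)) = g n" by simp
  then have "g (Suc n) = g n"
    using lifts_det[OF g[of n]] by (simp add: matrix_mul_assoc adj2_mult)
  then have "r (Suc n) = r n" using f(1) by (auto simp: g_def dest: injD)
  then show False using r by (metis n_not_Suc_n strict_mono_eq)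
qed

text \<open>The imaginary part of \<open>a z + b\<close> controls \<open>a\<close>, and subtracting
  \<open>a z\<close> then controls \<open>b\<close>. This will turn bounds on numerator and
  denominator of a Moebius map into bounds on the matrix entries.\<close>

lemma real_linear_form_bound:
  assumes "z \<in> upper_half_plane"
  shows "\<bar>a\<bar> \<le> cmod (of_real a * z + of_real b) / Im z"
    "\<bar>b\<bar> \<le> cmod (of_real a * z + of_real b) * (1 + cmod z / Im z)"
proof -
  define N where "N = cmod (of_real a * z + of_real b)"
  have z: "Im z > 0" using assms by (simp add: upper_half_plane_def)
  have "\<bar>a\<bar> * Im z \<le> N"
    using abs_Im_le_cmod[of "of_real a * z + of_real b"] z by (simp add: N_def abs_mult)
  then show a: "\<bar>a\<bar> \<le> cmod (of_real a * z + of_real b) / Im z"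
    using z by (simp add: N_def field_simps)
  have "\<bar>b\<bar> = cmod ((of_real a * z + of_real b) - of_real a * z)" by simp
  also have "\<dots> \<le> N + cmod (of_real a * z)"
    unfolding N_def by (rule norm_triangle_ineq4)
  also have "\<dots> = N + \<bar>a\<bar> * cmod z" by (simp add: norm_mult)
  also have "\<dots> \<le> N + N / Im z * cmod z"
    using a unfolding N_def by (intro add_left_mono mult_right_mono) auto
  also have "\<dots> = N * (1 + cmod z / Im z)" by (simp add: algebra_simps)
  finally show "\<bar>b\<bar> \<le> cmod (of_real a * z + of_real b) * (1 + cmod z / Im z)"
    by (simp add: N_def)
qed

section \<open>Limit points\<close>

lemma norm_le_entries:
  fixes A :: "real^2^2"
  assumes "\<And>i j. \<bar>A$i$j\<bar> \<le> K"
  shows "norm A \<le> 4 * K"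
proof -
  have row: "norm (A$i) \<le> 2 * K" for i
    using norm_le_l1_cart[of "A$i"] assms[of i 1] assms[of i 2]
    by (simp add: sum_2)
  have "norm A \<le> (\<Sum>i\<in>UNIV. norm (A$i))"
    unfolding norm_vec_def by (rule L2_set_le_sum) simp
  with row[of 1] row[of 2] show ?thesis by (simp add: sum_2)
qed

lemma Im_moebius:
  assumes "det A = 1" "Fin w = moebius A (Fin z)"
  defines "q \<equiv> of_real (A$2$1) * z + of_real (A$2$2)"
  shows "q \<noteq> 0" "w * q = of_real (A$1$1) * z + of_real (A$1$2)" "Im w * (cmod q)\<^sup>2 = Im z"
proof -
  define p where "p = of_real (A$1$1) * z + of_real (A$1$2)"
  show q: "q \<noteq> 0" using assms(2) by (auto simp: moebius_def q_def)
  have w: "w = p / q" using assms(2) q by (simp add: moebius_def q_def p_def)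
  then show "w * q = p" using q by simp
  \<comment> \<open>Multiplying by \<open>cnj q\<close> makes the factor of \<open>w\<close> real,
    so that its imaginary part can be read off.\<close>
  have "w * (q * cnj q) = p * cnj q" using w q by simp
  then have "w * of_real ((cmod q)\<^sup>2) = p * cnj q"
    by (simp only: complex_norm_square)
  then have "Im (w * of_real ((cmod q)\<^sup>2)) = Im (p * cnj q)" by simp
  also have "Im (p * cnj q) = det A * Im z"
    by (simp add: p_def q_def det_2 algebra_simps)
  finally show "Im w * (cmod q)\<^sup>2 = Im z" using assms(1) by simp
qed

text \<open>This is properness of the action on the half-plane. A lower bound on \<open>Im w\<close>
  bounds the denominator \<open>q\<close>, hence the numerator \<open>p = w q\<close>, hence both
  rows of the matrix.\<close>

lemma norm_bound_if_moebius_near: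
  assumes "z \<in> upper_half_plane" "w0 \<in> upper_half_plane"
  obtains R where "\<And>A w. det A = 1 \<Longrightarrow> Fin w = moebius A (Fin z) \<Longrightarrow>
    w \<in> ball w0 (Im w0 / 2) \<Longrightarrow> norm A \<le> R"
proof -
  have z: "Im z > 0" and w0: "Im w0 > 0" using assms by (auto simp: upper_half_plane_def)
  \<comment> \<open>\<open>Q\<close> bounds \<open>cmod q\<close>, because
    \<open>Im w * (cmod q)\<^sup>2 = Im z\<close> and \<open>Im w > Im w0 / 2\<close> on the
    ball.\<close>
  define Q where "Q = sqrt (2 * Im z / Im w0)"
  \<comment> \<open>\<open>M\<close> bounds \<open>cmod w\<close> on the ball; the summand 1 gives
    \<open>M \<ge> 1\<close>, so that \<open>M * Q\<close> bounds the denominator as well as the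
    numerator.\<close>
  define M where "M = cmod w0 + Im w0 / 2 + 1"
  \<comment> \<open>The last factor is the sum of the two factors in
    \<open>real_linear_form_bound\<close>, so \<open>K\<close> serves for both entries of a
    row.\<close>
  define K where "K = M * Q * (1 / Im z + 1 + cmod z / Im z)"
  have Q: "Q \<ge> 0" using z w0 by (simp add: Q_def)
  have "norm A \<le> 4 * K"
    if A: "det A = 1" and w: "Fin w = moebius A (Fin z)" "w \<in> ball w0 (Im w0 / 2)" for A w
  proof -
    define p q where "p = of_real (A$1$1) * z + of_real (A$1$2)"
      and "q = of_real (A$2$1) * z + of_real (A$2$2)"
    note Im = Im_moebius[OF A w(1), folded p_def q_def]
    have d: "cmod (w - w0) < Im w0 / 2" using w(2) by (simp add: dist_norm norm_minus_commute)
    then have "Im w > Im w0 / 2"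
      using abs_Im_le_cmod[of "w - w0"] by simp
    then have "Im w0 / 2 * (cmod q)\<^sup>2 \<le> Im z"
      unfolding Im(3)[symmetric] by (intro mult_right_mono) auto
    then have "(cmod q)\<^sup>2 \<le> 2 * Im z / Im w0" using w0 by (simp add: field_simps)
    then have q: "cmod q \<le> Q" unfolding Q_def by (rule real_le_rsqrt)
    have wM: "cmod w \<le> M" using norm_triangle_sub[of w w0] d by (simp add: M_def)
    have "cmod p = cmod w * cmod q" by (simp add: Im(2)[symmetric] norm_mult)
    also have "\<dots> \<le> M * Q" using q wM Q by (intro mult_mono) (auto simp: M_def w0 less_imp_le)
    finally have p: "cmod p \<le> M * Q" .
    have "1 * Q \<le> M * Q" using Q w0 by (intro mult_right_mono) (auto simp: M_def)
    with q have q: "cmod q \<le> M * Q" by simp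
    have bd: "\<bar>a\<bar> \<le> K \<and> \<bar>b\<bar> \<le> K" if ab: "cmod (of_real a * z + of_real b) \<le> M * Q" for a b :: real
    proof -
      have "cmod (of_real a * z + of_real b) * (1 / Im z) \<le> K"
        unfolding K_def using ab z by (intro mult_mono) (auto intro: order.trans[OF norm_ge_zero])
      moreover have "cmod (of_real a * z + of_real b) * (1 + cmod z / Im z) \<le> K"
        unfolding K_def using ab z by (intro mult_mono) (auto intro: order.trans[OF norm_ge_zero])
      ultimately show ?thesis
        using real_linear_form_bound[OF assms(1), where a = a and b = b] by simp
    qed
    have "\<bar>A$i$j\<bar> \<le> K" for i j
      using bd[of "A$1$1" "A$1$2"] bd[of "A$2$1" "A$2$2"] p q exhaust_2[of i] exhaust_2[of j]
      unfolding p_def q_def by (elim disjE) simp_all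
    then show ?thesis by (rule norm_le_entries)
  qed
  then show ?thesis by (rule that)
qed

text \<open>The orbit points in a small disc around \<open>w0\<close> come from lifts of bounded
  norm, of which there are finitely many.\<close>

lemma orbit_not_islimpt:
  assumes "Fuchsian \<Gamma>" "z \<in> upper_half_plane" "w0 \<in> upper_half_plane"
  shows "\<not> w0 islimpt {w. equivalent_under \<Gamma> z w}"
proof
  obtain R where R: "\<And>A w. det A = 1 \<Longrightarrow> Fin w = moebius A (Fin z) \<Longrightarrow>
    w \<in> ball w0 (Im w0 / 2) \<Longrightarrow> norm A \<le> R"
    using norm_bound_if_moebius_near[OF assms(2,3)] by blast
  let ?S = "{w. equivalent_under \<Gamma> z w} \<inter> ball w0 (Im w0 / 2)"
  have "Fin ` ?S \<subseteq> (\<lambda>A. moebius A (Fin z)) ` {A \<in> lifts \<Gamma>. norm A \<le> R}"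
  proof
    fix x assume "x \<in> Fin ` ?S"
    then obtain w where w: "x = Fin w" "equivalent_under \<Gamma> z w" "w \<in> ball w0 (Im w0 / 2)"
      by blast
    from w(2) obtain A where A: "A \<in> lifts \<Gamma>" "Fin w = moebius A (Fin z)"
      unfolding equivalent_under_lifts[OF Fuchsian_subgroup[OF assms(1)]] by blast
    then have "norm A \<le> R" using R lifts_det w(3) by blast
    with A w(1) show "x \<in> (\<lambda>A. moebius A (Fin z)) ` {A \<in> lifts \<Gamma>. norm A \<le> R}" by simp
  qed
  then have "finite (Fin ` ?S)"
    using finite_bounded_lifts[OF assms(1)] by (meson finite_imageI finite_subset)
  then have "finite ?S" by (rule finite_imageD) (simp add: inj_on_def)
  moreover assume "w0 islimpt {w. equivalent_under \<Gamma> z w}"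
  moreover have "Im w0 / 2 > 0" using assms(3) by (simp add: upper_half_plane_def)
  ultimately show False by (metis islimpt_eq_infinite_ball)
qed

text \<open>
  Lifts of pairwise different group elements, divided by their norms, subconverge to a matrix of
  rank one: it maps the whole sphere, except the point given by its kernel, to a single point.
\<close>

lemma limit_set_convergence:
  assumes "Fuchsian \<Gamma>" "x0 \<in> limit_set \<Gamma>"
  obtains f :: "nat \<Rightarrow> real^2^2" and y0
  where "\<And>n. f n \<in> lifts \<Gamma>" "\<And>y. y \<noteq> y0 \<Longrightarrow> (\<lambda>n. moebius (f n) y) \<longlonglongrightarrow> x0"
proof -
  note sub = Fuchsian_subgroup[OF assms(1)]
  from assms(2) obtain z where z: "z \<in> upper_half_plane" "x0 islimpt orbit_of \<Gamma> (Fin z)"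
    by (auto simp: limit_set_def)
  from z(2) obtain u where u: "\<And>n. u n \<in> orbit_of \<Gamma> (Fin z) - {x0}" "u \<longlonglongrightarrow> x0"
    unfolding islimpt_sequential by blast
  have "\<exists>A. A \<in> lifts \<Gamma> \<and> u n = moebius A (Fin z)" for n
    using u(1)[of n] unfolding orbit_of_lifts[OF sub] by blast
  then obtain f where f: "\<And>n. f n \<in> lifts \<Gamma>" "\<And>n. u n = moebius (f n) (Fin z)"
    by metis
  \<comment> \<open>Lifts of bounded norm yield only finitely many values. The sequence
    \<open>u\<close> never takes the value \<open>x0\<close> but tends to it, so it eventually
    leaves every finite set of values other than \<open>x0\<close>.\<close>
  have "filterlim (\<lambda>n. norm (f n)) at_top sequentially"
    unfolding filterlim_at_top
  proof
    fix R
    let ?E = "(\<lambda>A. moebius A (Fin z)) ` {A \<in> lifts \<Gamma>. norm A \<le> R} - {x0}"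
    have "finite ?E" using finite_bounded_lifts[OF assms(1)] by blast
    then have "open (- ?E)" by (intro open_Compl finite_imp_closed)
    with u(2) have "\<forall>\<^sub>F n in sequentially. u n \<in> - ?E"
      by (rule topological_tendstoD) simp
    then show "\<forall>\<^sub>F n in sequentially. R \<le> norm (f n)"
    proof eventually_elim
      case (elim n)
      show ?case
      proof (rule ccontr)
        assume "\<not> R \<le> norm (f n)"
        then have "f n \<in> {A \<in> lifts \<Gamma>. norm A \<le> R}" using f(1) by simp
        then have "u n \<in> ?E" using f(2) u(1)[of n] by blast
        with elim show False by blast
      qed
    qed
  qed
  then have inv: "(\<lambda>n. inverse (norm (f n))) \<longlonglongrightarrow> 0"
    by (rule tendsto_inverse_0_at_top)
  have nz: "norm (f n) \<noteq> 0" for n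
    using lifts_det[OF f(1)[of n]] by (auto simp: det_2)
  \<comment> \<open>Rescaling leaves the action unchanged and places the matrices on the compact
    unit sphere, while their determinants \<open>(inverse (norm (f n)))\<^sup>2\<close> tend to
    0.\<close>
  define B where "B n = inverse (norm (f n)) *\<^sub>R f n" for n
  have "\<forall>n. B n \<in> sphere 0 1" using nz by (simp add: B_def)
  then obtain B0 r where B0: "B0 \<in> sphere 0 1" and r: "strict_mono (r :: nat \<Rightarrow> nat)"
    and lim: "(B \<circ> r) \<longlonglongrightarrow> B0"
    using compact_sphere[of "0 :: real^2^2" 1] unfolding compact_def by blast
  have "B0 \<noteq> 0" using B0 by auto
  have "det (B n) = (inverse (norm (f n)))\<^sup>2" for n
  proof -
    have "det (B n) = (inverse (norm (f n)))\<^sup>2 * det (f n)"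
      by (simp add: B_def det_2 power2_eq_square algebra_simps)
    then show ?thesis using lifts_det[OF f(1)[of n]] by simp
  qed
  then have "(\<lambda>n. det (B n)) \<longlonglongrightarrow> 0"
    using tendsto_power[OF inv, of 2] by simp
  then have "((\<lambda>n. det (B n)) \<circ> r) \<longlonglongrightarrow> 0"
    using r by (rule LIMSEQ_subseq_LIMSEQ)
  moreover have "(\<lambda>n. det ((B \<circ> r) n)) \<longlonglongrightarrow> det B0" by (rule tendsto_det2[OF lim])
  ultimately have det0: "det B0 = 0"
    by (simp add: o_def LIMSEQ_unique)
  have B_act: "sphere_point (mat_act (B n) (homog y)) = moebius (f n) y" for n y
    using nz by (simp add: B_def mat_act_scaleR sphere_point_scaleR moebius_eq_sphere_point)
  have conv: "(\<lambda>n. moebius (f (r n)) y) \<longlonglongrightarrow> sphere_point (mat_act B0 (homog y))"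
    if "mat_act B0 (homog y) \<noteq> 0" for y
    using tendsto_sphere_point[OF tendsto_mat_act[OF lim] that] by (simp add: B_act)
  \<comment> \<open>As \<open>z\<close> is off the kernel, the convergence applies at
    \<open>z\<close> itself and identifies the common value of \<open>B0\<close> as
    \<open>x0\<close>, the limit of \<open>u\<close>.\<close>
  have z0: "mat_act B0 (homog (Fin z)) \<noteq> 0"
    using mat_act_kernel_upper_half_plane[OF z(1)] \<open>B0 \<noteq> 0\<close> by blast
  have "(u \<circ> r) \<longlonglongrightarrow> x0" using u(2) r by (rule LIMSEQ_subseq_LIMSEQ)
  with conv[OF z0] have x0: "sphere_point (mat_act B0 (homog (Fin z))) = x0"
    by (intro LIMSEQ_unique) (auto simp: o_def f(2))
  \<comment> \<open>Existence need not be settled here: the argument below has a kernel point at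
    hand before it uses that \<open>y0\<close> is one.\<close>
  define y0 where "y0 = (SOME y. mat_act B0 (homog y) = 0)"
  show ?thesis
  proof (rule that[of "f \<circ> r" y0])
    show "(f \<circ> r) n \<in> lifts \<Gamma>" for n using f(1) by simp
    fix y assume "y \<noteq> y0"
    have "mat_act B0 (homog y) \<noteq> 0"
    proof
      assume y: "mat_act B0 (homog y) = 0"
      then have "mat_act B0 (homog y0) = 0" unfolding y0_def by (rule someI)
      with y \<open>y \<noteq> y0\<close> \<open>B0 \<noteq> 0\<close> show False using mat_act_homog_kernel_unique by blast
    qed
    then show "(\<lambda>n. moebius ((f \<circ> r) n) y) \<longlonglongrightarrow> x0"
      using conv[of y] rank_one_common_value[OF det0 _ z0] x0 by simp
  qed
qed

text \<open>Take two orbit points other than the exceptional point \<open>y0\<close>. Their images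
  under \<open>f n\<close> stay in the orbit and tend to \<open>x0\<close>; by injectivity they
  differ, so at least one of them is not \<open>x0\<close>.\<close>

lemma limit_set_islimpt_orbit:
  assumes "Fuchsian \<Gamma>" "x0 \<in> limit_set \<Gamma>" "infinite (orbit_of \<Gamma> y)"
  shows "x0 islimpt orbit_of \<Gamma> y"
proof (rule islimptI)
  note sub = Fuchsian_subgroup[OF assms(1)]
  obtain f y0 where f: "\<And>n. f n \<in> lifts \<Gamma>"
    "\<And>y. y \<noteq> y0 \<Longrightarrow> (\<lambda>n. moebius (f n) y) \<longlonglongrightarrow> x0"
    using limit_set_convergence[OF assms(1,2)] by metis
  have "infinite (orbit_of \<Gamma> y - {y0})" using assms(3) by simp
  then obtain y1 where y1: "y1 \<in> orbit_of \<Gamma> y - {y0}" by (metis finite.emptyI ex_in_conv)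
  have "infinite (orbit_of \<Gamma> y - {y0} - {y1})" using assms(3) by simp
  then obtain y2 where y2: "y2 \<in> orbit_of \<Gamma> y - {y0} - {y1}" by (metis finite.emptyI ex_in_conv)
  have orb: "moebius (f n) x \<in> orbit_of \<Gamma> y" if "x \<in> orbit_of \<Gamma> y" for n x
  proof -
    from that obtain A where A: "A \<in> lifts \<Gamma>" "x = moebius A y"
      unfolding orbit_of_lifts[OF sub] by blast
    then have "moebius (f n) x = moebius (f n ** A) y"
      using lifts_det[OF f(1)[of n]] lifts_det[OF A(1)] by (simp add: moebius_mult)
    then show ?thesis
      unfolding orbit_of_lifts[OF sub] using lifts_mult[OF sub f(1) A(1)] by blast
  qed
  fix T assume T: "x0 \<in> T" "open T"
  have "\<forall>\<^sub>F n in sequentially. moebius (f n) y1 \<in> T \<and> moebius (f n) y2 \<in> T"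
    using f(2) y1 y2 T by (intro eventually_conj topological_tendstoD) auto
  then obtain n where n: "moebius (f n) y1 \<in> T" "moebius (f n) y2 \<in> T"
    by (auto simp: eventually_sequentially)
  have "moebius (f n) y1 \<noteq> moebius (f n) y2"
    using inj_moebius[OF lifts_det[OF f(1)]] y2 by (auto dest: injD)
  then show "\<exists>y'\<in>orbit_of \<Gamma> y. y' \<in> T \<and> y' \<noteq> x0"
    using n orb[of y1 n] orb[of y2 n] y1 y2 by (metis DiffD1)
qed

section \<open>Infinite orbits, including those in the lower half-plane\<close>

definition sphere_cnj :: "riemann_sphere \<Rightarrow> riemann_sphere" where
  "sphere_cnj x = (case x of Fin z \<Rightarrow> Fin (cnj z) | Infty \<Rightarrow> Infty)"

lemma moebius_cnj: "moebius A (Fin (cnj z)) = sphere_cnj (moebius A (Fin z))"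
proof -
  have "of_real c * cnj z + of_real d = cnj (of_real c * z + of_real d)" for c d by simp
  then show ?thesis
    by (simp add: moebius_def sphere_cnj_def del: complex_cnj_add complex_cnj_mult)
qed

text \<open>The definition of \<open>elementary\<close> does not mention the lower half-plane. As
  the matrices are real, complex conjugation carries orbits there to orbits in the upper
  half-plane.\<close>

lemma nonelementary_infinite_orbit:
  assumes "subgroup \<Gamma> PSL2R" "\<not> elementary \<Gamma>"
  shows "infinite (orbit_of \<Gamma> x)"
proof (cases "x \<in> Fin ` upper_half_plane \<union> extended_reals")
  case True
  with assms(2) show ?thesis unfolding elementary_def by blast
next
  case False
  then obtain z where x: "x = Fin z" and z: "Im z < 0"
    by (cases x) (force simp: extended_reals_def upper_half_plane_def)+
  have "orbit_of \<Gamma> (Fin (cnj z)) = sphere_cnj ` orbit_of \<Gamma> x"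
    unfolding orbit_of_lifts[OF assms(1)] x by (simp add: moebius_cnj image_image)
  moreover have "infinite (orbit_of \<Gamma> (Fin (cnj z)))"
    using assms(2) z unfolding elementary_def upper_half_plane_def by force
  ultimately show ?thesis by (metis finite_imageI)
qed

section \<open>Meromorphic functions as open maps to the sphere\<close>

lemma sphere_map_analytic: "h analytic_on {z} \<Longrightarrow> sphere_map h z = Fin (h z)"
  by (simp add: sphere_map_def analytic_at_imp_no_pole)

text \<open>The identity theorem: a value taken on a whole ball is taken on all of the connected set
  \<open>A\<close>.\<close>

lemma nicely_meromorphic_locally_nonconstant:
  assumes "h nicely_meromorphic_on A" "open A" "connected A" "\<not> h constant_on A"
    and "z0 \<in> A" "e > 0"
  shows "\<not> h constant_on ball z0 e"
proof
  assume "h constant_on ball z0 e"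
  then obtain c where c: "\<And>z. z \<in> ball z0 e \<Longrightarrow> h z = c" by (auto simp: constant_on_def)
  have "\<forall>\<^sub>F z in at z0. h z = c"
    using \<open>e > 0\<close> c by (auto simp: eventually_at dist_commute intro!: exI[of _ e])
  then have "\<exists>\<^sub>F z in at z0. h z = c" by (rule eventually_frequently[rotated]) simp
  then have "\<And>w. w \<in> A \<Longrightarrow> h w = c"
    using frequently_eq_meromorphic_imp_constant assms by blast
  with assms(4) show False by (auto simp: constant_on_def)
qed

text \<open>Away from poles this is the classical open mapping theorem. At a pole the theorem is
  applied to \<open>1 / h\<close>, extended by 0, and inversion turns a disc around 0 into a
  neighbourhood of \<open>Infty\<close>.\<close>

lemma sphere_map_open_mapping:
  assumes h: "h nicely_meromorphic_on A" "open A" "connected A" "\<not> h constant_on A"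
    and V: "open V" "V \<subseteq> A" "z0 \<in> V"
  obtains U where "open U" "sphere_map h z0 \<in> U" "U \<subseteq> sphere_map h ` V"
proof (cases "is_pole h z0")
  case False
  with h V have "h analytic_on {z0}"
    by (intro nicely_meromorphic_on_imp_analytic_at[of h A]) auto
  then obtain S where S: "open S" "z0 \<in> S" "h holomorphic_on S"
    by (auto simp: analytic_at)
  then obtain e where e: "e > 0" "ball z0 e \<subseteq> S \<inter> V"
    using V open_contains_ball[of "S \<inter> V"] by (metis IntI open_Int)
  have hol: "h holomorphic_on ball z0 e" using S(3) e(2) holomorphic_on_subset by blast
  have "\<not> h constant_on ball z0 e"
    using nicely_meromorphic_locally_nonconstant[OF h] V e(1) by blast
  then have op: "open (h ` ball z0 e)"
    using open_mapping_thm[OF hol, of "ball z0 e"] by simp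
  have sm: "sphere_map h v = Fin (h v)" if "v \<in> ball z0 e" for v
    using hol that by (intro sphere_map_analytic) (auto simp: analytic_at)
  show ?thesis
  proof (rule that)
    show "open (Fin ` h ` ball z0 e)" using op by (simp add: open_Fin_image)
    show "sphere_map h z0 \<in> Fin ` h ` ball z0 e" using sm e(1) by simp
    have "Fin ` h ` ball z0 e = sphere_map h ` ball z0 e"
      using sm by (simp add: image_image)
    then show "Fin ` h ` ball z0 e \<subseteq> sphere_map h ` V" using e(2) by blast
  qed
next
  case True
  have "h meromorphic_on {z0}"
    using h(1) V meromorphic_on_subset[of h A "{z0}"] by (auto simp: nicely_meromorphic_on_def)
  then obtain r where r: "r > 0" "h analytic_on ball z0 r - {z0}"
    using meromorphic_on_isolated_singularity by (auto simp: isolated_singularity_at_def)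
  have "\<forall>\<^sub>F z in at z0. h z \<noteq> 0"
    using True unfolding is_pole_def by (rule filterlim_at_infinity_imp_eventually_ne)
  then obtain d where d: "d > 0" "\<And>z. z \<noteq> z0 \<Longrightarrow> dist z z0 < d \<Longrightarrow> h z \<noteq> 0"
    by (auto simp: eventually_at)
  obtain s where s: "s > 0" "ball z0 s \<subseteq> V" using V open_contains_ball by blast
  \<comment> \<open>The punctured disc of radius \<open>e\<close> contains no singularity and no
    zero of \<open>h\<close>, so the reciprocal is holomorphic on the disc and vanishes only at
    \<open>z0\<close>.\<close>
  define e where "e = min r (min d s)"
  let ?N = "ball z0 e"
  have e: "e > 0" "?N \<subseteq> ball z0 r" "?N \<subseteq> V" "\<And>z. z \<in> ?N - {z0} \<Longrightarrow> h z \<noteq> 0"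
    using r(1) d s by (auto simp: e_def dist_commute)
  have an: "h analytic_on ?N - {z0}"
    using r(2) e(2) by (rule analytic_on_subset[OF _ Diff_mono]) simp
  define f where "f = (\<lambda>x. if x = z0 then 0 else inverse (h x))"
  have hol: "f holomorphic_on ?N"
    unfolding f_def
    using e(4) by (intro is_pole_inverse_holomorphic analytic_imp_holomorphic an True) auto
  have "\<not> f constant_on ?N"
  proof
    assume "f constant_on ?N"
    then have "f (z0 + of_real (e / 2)) = f z0"
      using e(1) by (auto simp: constant_on_def dist_norm)
    moreover have "z0 + of_real (e / 2) \<in> ?N - {z0}" using e(1) by (simp add: dist_norm)
    ultimately show False using e(4) by (auto simp: f_def)
  qed
  then have "open (f ` ?N)"
    using open_mapping_thm[OF hol, of ?N] by simp
  moreover have "0 \<in> f ` ?N" using e(1) by (auto simp: f_def intro!: image_eqI[of _ _ z0])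
  ultimately obtain t where t: "t > 0" "ball 0 t \<subseteq> f ` ?N"
    using open_contains_ball by blast
  show ?thesis
  proof (rule that)
    show "open (- Fin ` cball 0 (1 / t))" by (simp add: open_Compl_Fin_image)
    show "sphere_map h z0 \<in> - Fin ` cball 0 (1 / t)" using True by (auto simp: sphere_map_def)
    show "- Fin ` cball 0 (1 / t) \<subseteq> sphere_map h ` V"
    proof
      fix x assume x: "x \<in> - Fin ` cball 0 (1 / t)"
      show "x \<in> sphere_map h ` V"
      proof (cases x)
        case Infty
        then have "x = sphere_map h z0" using True by (simp add: sphere_map_def)
        then show ?thesis using V(3) by (rule image_eqI)
      next
        case (Fin w)
        with x have "w \<notin> cball 0 (1 / t)" by blast
        then have w: "cmod w > 1 / t" by simp
        have "cmod w > 0" using w t(1) by (intro less_trans[OF _ w]) simp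
        then have "w \<noteq> 0" by simp
        have "cmod (inverse w) < t"
          using w t(1) \<open>w \<noteq> 0\<close> by (simp add: norm_divide field_simps)
        then have "inverse w \<in> ball 0 t" by simp
        then obtain v where v: "v \<in> ?N" "inverse w = f v" using t(2) by blast
        with \<open>w \<noteq> 0\<close> have "v \<noteq> z0" by (auto simp: f_def)
        with v have "h v = w" by (simp add: f_def)
        moreover have "h analytic_on {v}"
          using v(1) \<open>v \<noteq> z0\<close> by (intro analytic_on_subset[OF an]) simp
        ultimately have "x = sphere_map h v" by (simp add: Fin sphere_map_analytic)
        then show ?thesis using v(1) e(3) by blast
      qed
    qed
  qed
qed

section \<open>Equivariant functions\<close>

lemma open_upper_half_plane: "open upper_half_plane"
  unfolding upper_half_plane_def by (rule open_halfspace_Im_gt)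

lemma connected_upper_half_plane: "connected upper_half_plane"
  unfolding upper_half_plane_def by (intro convex_connected convex_halfspace_Im_gt)

lemma equivariant_lifts:
  assumes "subgroup \<Gamma> PSL2R" "equivariant_function \<Gamma> h" "A \<in> lifts \<Gamma>"
    and "z \<in> upper_half_plane" "w \<in> upper_half_plane" "Fin w = moebius A (Fin z)"
  shows "sphere_map h w = moebius A (sphere_map h z)"
proof -
  have "{A, - A} \<in> \<Gamma>" using assms(3) by (simp add: lifts_def)
  then have "Fin w = PSL2R_act {A, - A} (Fin z) \<longrightarrow>
      sphere_map h w = PSL2R_act {A, - A} (sphere_map h z)"
    using assms(2,4,5) unfolding equivariant_function_def by blast
  then show ?thesis using assms(6) by (simp add: PSL2R_act_pair)
qed

text \<open>By equivariance a constant value would be fixed by the whole group, and its orbit would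
  be finite.\<close>

lemma equivariant_not_constant:
  assumes "subgroup \<Gamma> PSL2R" "\<not> elementary \<Gamma>" "equivariant_function \<Gamma> h"
  shows "\<not> h constant_on upper_half_plane"
proof
  assume "h constant_on upper_half_plane"
  then obtain c where c: "\<And>z. z \<in> upper_half_plane \<Longrightarrow> h z = c"
    by (auto simp: constant_on_def)
  \<comment> \<open>Holomorphy excludes poles, so \<open>sphere_map h\<close> takes the finite value
    \<open>Fin c\<close> throughout.\<close>
  have "h holomorphic_on upper_half_plane"
    using c by (subst holomorphic_cong[OF refl, of _ _ "\<lambda>_. c"]) auto
  then have "h analytic_on {z}" if "z \<in> upper_half_plane" for z
    using that open_upper_half_plane by (auto simp: analytic_at)
  then have sm: "sphere_map h z = Fin c" if "z \<in> upper_half_plane" for z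
    using that c by (simp add: sphere_map_analytic)
  have i: "\<i> \<in> upper_half_plane" by (simp add: upper_half_plane_def)
  have "moebius A (Fin c) = Fin c" if A: "A \<in> lifts \<Gamma>" for A
  proof -
    obtain w where w: "w \<in> upper_half_plane" "Fin w = moebius A (Fin \<i>)"
      using moebius_upper_half_plane[OF lifts_det[OF A] i] by force
    from equivariant_lifts[OF assms(1,3) A i w] sm[OF i] sm[OF w(1)] show ?thesis by simp
  qed
  then have "orbit_of \<Gamma> (Fin c) \<subseteq> {Fin c}"
    unfolding orbit_of_lifts[OF assms(1)] by blast
  then have "finite (orbit_of \<Gamma> (Fin c))" by (rule finite_subset) simp
  with nonelementary_infinite_orbit[OF assms(1,2)] show False by blast
qed

theorem corollary3p3:
  fixes \<Gamma> :: "(real^2^2) set set" and h :: "complex \<Rightarrow> complex"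
  assumes "Fuchsian \<Gamma>"
    and "\<not> elementary \<Gamma>"
    and "equivariant_function \<Gamma> h"
    and "limit_set \<Gamma> \<inter> sphere_map h ` upper_half_plane \<noteq> {}"
  shows "sphere_map h ` upper_half_plane = UNIV \<and>
    (\<forall>x :: riemann_sphere. \<exists>S \<subseteq> {z \<in> upper_half_plane. sphere_map h z = x}.
       infinite S \<and> (\<forall>z\<in>S. \<forall>w\<in>S. z \<noteq> w \<longrightarrow> \<not> equivalent_under \<Gamma> z w))"
proof -
  note sub = Fuchsian_subgroup[OF assms(1)]
  obtain z0 where z0: "z0 \<in> upper_half_plane" "sphere_map h z0 \<in> limit_set \<Gamma>"
    using assms(4) by blast
  have mero: "h nicely_meromorphic_on upper_half_plane"
    using assms(3) by (simp add: equivariant_function_def)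
  have main: "\<exists>S \<subseteq> {z \<in> upper_half_plane. sphere_map h z = x}.
       infinite S \<and> (\<forall>z\<in>S. \<forall>w\<in>S. z \<noteq> w \<longrightarrow> \<not> equivalent_under \<Gamma> z w)" for x
  proof -
    define P where "P = {z \<in> upper_half_plane. sphere_map h z = x}"
    define rep where "rep z = (SOME w. w \<in> P \<and> equivalent_under \<Gamma> z w)" for z
    have rep: "rep z \<in> P" "equivalent_under \<Gamma> z (rep z)" if "z \<in> P" for z
    proof -
      have "z \<in> P \<and> equivalent_under \<Gamma> z z" using that equivalent_under_refl[OF sub] by blast
      then have "rep z \<in> P \<and> equivalent_under \<Gamma> z (rep z)" unfolding rep_def by (rule someI)
      then show "rep z \<in> P" "equivalent_under \<Gamma> z (rep z)" by auto
    qed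
    have rep_eq: "rep z = rep w" if "equivalent_under \<Gamma> z w" for z w
    proof -
      have "equivalent_under \<Gamma> z u \<longleftrightarrow> equivalent_under \<Gamma> w u" for u
        using that equivalent_under_trans[OF sub] equivalent_under_sym[OF sub] by blast
      then show ?thesis by (simp add: rep_def)
    qed
    have rep_inj: "z = w" if "z \<in> rep ` P" "w \<in> rep ` P" "equivalent_under \<Gamma> z w" for z w
    proof -
      obtain z' w' where *: "z' \<in> P" "z = rep z'" "w' \<in> P" "w = rep w'"
        using \<open>z \<in> rep ` P\<close> \<open>w \<in> rep ` P\<close> by blast
      then have "equivalent_under \<Gamma> z' w"
        using rep(2)[of z'] that(3) equivalent_under_trans[OF sub] by blast
      then have "equivalent_under \<Gamma> z' w'"
        using rep(2)[of w'] * equivalent_under_trans[OF sub] equivalent_under_sym[OF sub] by blast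
      then show ?thesis using rep_eq * by simp
    qed
    have "z0 islimpt (\<Union>s \<in> rep ` P. {w. equivalent_under \<Gamma> s w})"
    proof (rule islimptI)
      fix T assume T: "z0 \<in> T" "open T"
      have "open (T \<inter> upper_half_plane)" "z0 \<in> T \<inter> upper_half_plane"
        using T z0(1) open_upper_half_plane by auto
      then obtain U where U: "open U" "sphere_map h z0 \<in> U"
        "U \<subseteq> sphere_map h ` (T \<inter> upper_half_plane)"
        using sphere_map_open_mapping[OF mero open_upper_half_plane connected_upper_half_plane
            equivariant_not_constant[OF sub assms(2,3)] _ inf_le2] by metis
      \<comment> \<open>The orbit of \<open>x\<close> enters every neighbourhood of
        \<open>sphere_map h z0\<close>, in particular the set \<open>U\<close> covered by values of
        \<open>h\<close> near \<open>z0\<close>.\<close>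
      have "sphere_map h z0 islimpt orbit_of \<Gamma> x"
        using limit_set_islimpt_orbit[OF assms(1) z0(2) nonelementary_infinite_orbit[OF sub assms(2)]] .
      then obtain y where y: "y \<in> orbit_of \<Gamma> x" "y \<in> U" "y \<noteq> sphere_map h z0"
        using U(2,1) by (rule islimptE)
      then obtain v where v: "v \<in> T" "v \<in> upper_half_plane" "sphere_map h v = y"
        using U(3) by blast
      from y(1) obtain A where A: "A \<in> lifts \<Gamma>" "y = moebius A x"
        unfolding orbit_of_lifts[OF sub] by blast
      \<comment> \<open>Applying the inverse of \<open>A\<close> moves \<open>v\<close> to an
        equivalent point \<open>u\<close> and, by equivariance, its value \<open>y\<close> back to
        \<open>x\<close>.\<close>
      note A' = lifts_adj2[OF sub A(1)]
      obtain u where u: "u \<in> upper_half_plane" "Fin u = moebius (adj2 A) (Fin v)"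
        using moebius_upper_half_plane[OF lifts_det[OF A'] v(2)] by force
      have "sphere_map h u = moebius (adj2 A) y"
        using equivariant_lifts[OF sub assms(3) A' v(2) u] v(3) by simp
      also have "\<dots> = x" unfolding A(2) by (rule moebius_adj2(1)[OF lifts_det[OF A(1)]])
      finally have "u \<in> P" using u(1) by (simp add: P_def)
      have "equivalent_under \<Gamma> v u"
        unfolding equivalent_under_lifts[OF sub] using A' u(2) by blast
      then have "equivalent_under \<Gamma> (rep u) v"
        using rep(2)[OF \<open>u \<in> P\<close>] equivalent_under_trans[OF sub] equivalent_under_sym[OF sub] by blast
      moreover have "v \<noteq> z0" using v(3) y(3) by blast
      ultimately show "\<exists>v\<in>(\<Union>s \<in> rep ` P. {w. equivalent_under \<Gamma> s w}). v \<in> T \<and> v \<noteq> z0"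
        using \<open>u \<in> P\<close> v(1) by blast
    qed
    moreover have "\<not> z0 islimpt {w. equivalent_under \<Gamma> s w}" if "s \<in> rep ` P" for s
      using that rep(1) orbit_not_islimpt[OF assms(1) _ z0(1), of s] by (auto simp: P_def)
    \<comment> \<open>A limit point of a finite union is a limit point of one of its members, here a
      single orbit.\<close>
    ultimately have "infinite (rep ` P)"
      using islimpt_finite_union_iff[of "rep ` P" z0 "\<lambda>s. {w. equivalent_under \<Gamma> s w}"] by blast
    moreover have "rep ` P \<subseteq> P" using rep(1) by blast
    ultimately show ?thesis
      unfolding P_def[symmetric] using rep_inj by (intro exI[of _ "rep ` P"] conjI ballI impI notI)
        simp_all
  qed
  \<comment> \<open>Surjectivity follows because an infinite set of preimages is nonempty.\<close>
  have "x \<in> sphere_map h ` upper_half_plane" for x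
  proof -
    from main[of x] obtain S where "S \<subseteq> {z \<in> upper_half_plane. sphere_map h z = x}" "infinite S"
      by blast
    moreover from \<open>infinite S\<close> obtain z where "z \<in> S"
      using infinite_imp_nonempty by blast
    ultimately have "z \<in> upper_half_plane" "sphere_map h z = x" by auto
    then show ?thesis by blast
  qed
  with main show ?thesis by blast
qed

end
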